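(* Let $n\ge 1$ and let $\hat M\subset\mathbb S^{n+1}$ be a weakly convex body in a hemisphere. Let $x_0\in\mathbb S^{n+1}$ be such that $\hat M$ is contained in the closed hemisphere $\mathcal H(x_0)$ with equator $\mathcal S(x_0)$. Suppose that $\hat M$ satisfies an interior sphere condition with respect to $x_0$ at all points $p\in\hat M\cap\mathcal S(x_0)$. Then either $\hat M=\mathcal H(x_0)$ or $\hat M$ is contained in an open hemisphere.
   Context: $\mathbb S^{n+1}=\{x\in\mathbb R^{n+2}:|x|=1\}$ with the round metric. For $x\in\mathbb S^{n+1}$: $\mathcal H(x)=\{p\in\mathbb S^{n+1}:\langle p,x\rangle\ge 0\}$ is the closed hemisphere centered at $x$ and $\mathcal S(x)=\mathcal H(x)\setminus\operatorname{int}\mathcal H(x)$ its equator; an open hemisphere is a set $\operatorname{int}\mathcal H(y)$, $y\in\mathbb S^{n+1}$. A set $\hat M\subset\mathbb S^{n+1}$ is a weakly convex set in a hemisphere if there is $x\in\mathbb S^{n+1}$ with $\hat M\subset\mathcal H(x)$ and for arbitrary $p,q\in\hat M$ there exists a minimizing geodesic of $\mathbb S^{n+1}$ connecting $p$ and $q$ which is contained in $\hat M$. A weakly convex body in a hemisphere is a compact weakly convex set in a hemisphere with nonempty interior. For $x\in\mathbb S^{n+1}$, $\mathcal P_x:\mathbb S^{n+1}\setminus\{-x\}\to\mathbb R^{n+1}$ is the stereographic projection mapping $x$ to $0$, sending a point at geodesic distance $r$ from $x$ in the unit direction $\xi\in T_x\mathbb S^{n+1}\cong\mathbb R^{n+1}$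 to $2\tan(r/2)\,\xi$. A set $\hat M$ with $\overline{\hat M}\subset\mathbb S^{n+1}\setminus\{-x\}$ satisfies an interior sphere condition at $p\in\overline{\hat M}$ with respect to $x$ if $\mathcal P_x(\overline{\hat M})\subset\mathbb R^{n+1}$ satisfies an interior sphere condition at $\mathcal P_x(p)$, i.e. there is a Euclidean open ball $B\subset\mathcal P_x(\overline{\hat M})$ of positive radius with $\mathcal P_x(p)\in\partial B$ and $\overline B$ meeting the boundary of $\mathcal P_x(\overline{\hat M})$ only in $\mathcal P_x(p)$. *)

theory Defs
  imports "HOL-Analysis.Analysis"
begin

text \<open>
  The Euclidean space \<open>'a\<close> plays the role of \<open>\<real>\<^sup>n\<^sup>+\<^sup>2\<close> and \<open>unit_sphere\<close> that of \<open>\<bbbS>\<^sup>n\<^sup>+\<^sup>1\<close>.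
  Interiors of subsets of the sphere are taken in the subspace topology of the sphere.
\<close>

abbreviation unit_sphere :: "'a::euclidean_space set" where
  "unit_sphere \<equiv> sphere 0 1"

definition sphere_interior :: "'a::euclidean_space set \<Rightarrow> 'a set" where
  "sphere_interior A = top_of_set unit_sphere interior_of A"

definition hemisphere :: "'a::euclidean_space \<Rightarrow> 'a set" where
  "hemisphere x = {p \<in> unit_sphere. p \<bullet> x \<ge> 0}"

definition equator :: "'a::euclidean_space \<Rightarrow> 'a set" where
  "equator x = hemisphere x - sphere_interior (hemisphere x)"

definition open_hemisphere :: "'a::euclidean_space set \<Rightarrow> bool" where
  "open_hemisphere U \<longleftrightarrow> (\<exists>y\<in>unit_sphere. U = sphere_interior (hemisphere y))"

text \<open>The Riemannian distance of the round metric; only meaningful on the unit sphere.\<close>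

definition geodesic_dist :: "'a::euclidean_space \<Rightarrow> 'a \<Rightarrow> real" where
  "geodesic_dist p q = arccos (p \<bullet> q)"

text \<open>
  Minimizing geodesics are parametrized by arc length, so they are the curves that realise
  the distance between any two of their points. For antipodal end points they are not unique.
\<close>

definition minimizing_geodesic :: "(real \<Rightarrow> 'a::euclidean_space) \<Rightarrow> 'a \<Rightarrow> 'a \<Rightarrow> bool" where
  "minimizing_geodesic \<gamma> p q \<longleftrightarrow>
     \<gamma> ` {0..geodesic_dist p q} \<subseteq> unit_sphere \<and>
     \<gamma> 0 = p \<and> \<gamma> (geodesic_dist p q) = q \<and>
     (\<forall>s\<in>{0..geodesic_dist p q}. \<forall>t\<in>{0..geodesic_dist p q}.
        geodesic_dist (\<gamma> s) (\<gamma> t) = \<bar>s - t\<bar>)"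

definition weakly_convex_in_hemisphere :: "'a::euclidean_space set \<Rightarrow> bool" where
  "weakly_convex_in_hemisphere M \<longleftrightarrow>
     (\<exists>x\<in>unit_sphere. M \<subseteq> hemisphere x) \<and>
     (\<forall>p\<in>M. \<forall>q\<in>M. \<exists>\<gamma>. minimizing_geodesic \<gamma> p q \<and> \<gamma> ` {0..geodesic_dist p q} \<subseteq> M)"

definition weakly_convex_body_in_hemisphere :: "'a::euclidean_space set \<Rightarrow> bool" where
  "weakly_convex_body_in_hemisphere M \<longleftrightarrow>
     weakly_convex_in_hemisphere M \<and> compact M \<and> sphere_interior M \<noteq> {}"

text \<open>
  The target \<open>\<real>\<^sup>n\<^sup>+\<^sup>1\<close> of the stereographic projection centred at \<open>x\<close> is the tangent space at \<open>x\<close>,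
  realised as the hyperplane orthogonal to \<open>x\<close> with the induced Euclidean structure.
\<close>

definition tangent_space :: "'a::euclidean_space \<Rightarrow> 'a set" where
  "tangent_space x = {v. v \<bullet> x = 0}"

text \<open>
  The unit direction from \<open>x\<close> to \<open>p\<close> is the normalised orthogonal projection of \<open>p\<close> to the
  tangent space. For \<open>p = x\<close> the convention \<open>sgn 0 = 0\<close> gives the correct value \<open>0\<close>.
\<close>

definition stereographic :: "'a::euclidean_space \<Rightarrow> 'a \<Rightarrow> 'a" where
  "stereographic x p = (2 * tan (geodesic_dist x p / 2)) *\<^sub>R sgn (p - (p \<bullet> x) *\<^sub>R x)"

text \<open>\<open>cos r *\<^sub>R x + sin r *\<^sub>R \<xi>\<close> is the point at distance \<open>r\<close> from \<open>x\<close> in direction \<open>\<xi>\<close>.\<close>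

lemma stereographic_polar:
  assumes "x \<in> unit_sphere" "\<xi> \<in> tangent_space x" "norm \<xi> = 1" "0 \<le> r" "r < pi"
  shows "stereographic x (cos r *\<^sub>R x + sin r *\<^sub>R \<xi>) = (2 * tan (r / 2)) *\<^sub>R \<xi>"
proof -
  have x: "x \<bullet> x = 1" and o: "\<xi> \<bullet> x = 0" "x \<bullet> \<xi> = 0"
    using assms by (simp_all add: dot_square_norm tangent_space_def inner_commute)
  have s: "0 < sin r" if "r \<noteq> 0"
    using assms that by (intro sin_gt_zero) auto
  have "sgn (sin r *\<^sub>R \<xi>) = \<xi>" if "r \<noteq> 0"
    using s[OF that] assms(3) by (simp add: sgn_scaleR sgn_div_norm)
  then show ?thesis
    using assms(4,5) x o
    by (cases "r = 0")
       (simp_all add: stereographic_def geodesic_dist_def inner_add_left inner_add_right arccos_cos)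
qed

text \<open>
  Interior sphere condition for a subset \<open>K\<close> of a Euclidean space given as a linear subspace \<open>V\<close>:
  balls are balls of \<open>V\<close>, and the boundary of \<open>K\<close> is taken relative to \<open>V\<close>.
\<close>

definition interior_sphere_condition_in ::
    "'a::euclidean_space set \<Rightarrow> 'a set \<Rightarrow> 'a \<Rightarrow> bool" where
  "interior_sphere_condition_in V K a \<longleftrightarrow>
     (\<exists>c\<in>V. \<exists>\<rho>>0.
        V \<inter> ball c \<rho> \<subseteq> K \<and>
        a \<in> V \<inter> sphere c \<rho> \<and>
        (V \<inter> cball c \<rho>) \<inter> (top_of_set V frontier_of K) = {a})"

definition interior_sphere_condition ::
    "'a::euclidean_space set \<Rightarrow> 'a \<Rightarrow> 'a \<Rightarrow> bool" where
  "interior_sphere_condition M x p \<longleftrightarrow>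
     closure M \<subseteq> unit_sphere - {- x} \<and> p \<in> closure M \<and>
     interior_sphere_condition_in (tangent_space x)
       (stereographic x ` closure M) (stereographic x p)"

end

theory Submission
  imports Defs
begin

text \<open>
  Call a vector positive if it is a positive multiple of a point of \<open>M\<close>. By weak convexity, a
  nonzero sum of positive vectors is positive. If \<open>M\<close> contains no antipodal pair, then the
  positive vectors form a convex set avoiding \<open>0\<close>, so \<open>0\<close> is not in the compact set
  \<open>convex hull M\<close>, and a separating hyperplane gives the open hemisphere. If \<open>M\<close> contains \<open>p\<close> and
  \<open>- p\<close>, then \<open>p\<close> lies on the equator, and the interior sphere condition provides a round cap in \<open>M\<close>
  which is tangent to the equator at \<open>p\<close>. For every \<open>z\<close> in the open hemisphere around \<open>x0\<close> this cap
  contains the direction of \<open>p + t z\<close> for small \<open>t > 0\<close>; adding \<open>- p\<close> gives \<open>z \<in> M\<close>.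
\<close>

section \<open>Unit vectors, minimizing geodesics and sums of positive vectors\<close>

lemma unit_sphere_inner_self: "x \<in> unit_sphere \<Longrightarrow> x \<bullet> x = 1"
  by (simp add: dot_square_norm)

lemma unit_sphere_inner_bounds:
  assumes "p \<in> unit_sphere" "q \<in> unit_sphere"
  shows "-1 \<le> p \<bullet> q" "p \<bullet> q \<le> 1"
  using Cauchy_Schwarz_ineq2[of p q] assms by (auto simp: abs_le_iff)

lemma unit_sphere_eqI:
  assumes "p \<in> unit_sphere" "q \<in> unit_sphere" "p \<bullet> q = 1"
  shows "p = q"
proof -
  have "(p - q) \<bullet> (p - q) = 0"
    using assms unit_sphere_inner_self[of p] unit_sphere_inner_self[of q]
    by (simp add: inner_diff_left inner_diff_right inner_commute)
  then show ?thesis by simp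
qed

text \<open>Parametrization by arc length fixes all inner products among \<open>p\<close>,
  \<open>q\<close> and \<open>\<gamma> u\<close>, so the squared norm of the difference of the two
  sides is a trigonometric expression, and it vanishes. The sine stays on the left, so that equal
  and antipodal end points need no division.\<close>

lemma minimizing_geodesic_point:
  assumes "minimizing_geodesic \<gamma> p q" "0 \<le> u" "u \<le> geodesic_dist p q"
  shows "sin (geodesic_dist p q) *\<^sub>R \<gamma> u = sin (geodesic_dist p q - u) *\<^sub>R p + sin u *\<^sub>R q"
proof -
  define d where "d = geodesic_dist p q"
  define w where "w = \<gamma> u"
  have d: "0 \<le> u" "u \<le> d" using assms by (auto simp: d_def)
  have sph: "\<And>t. t \<in> {0..d} \<Longrightarrow> \<gamma> t \<in> unit_sphere" and \<gamma>: "\<gamma> 0 = p" "\<gamma> d = q"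
    and dist: "\<And>s t. s \<in> {0..d} \<Longrightarrow> t \<in> {0..d} \<Longrightarrow> geodesic_dist (\<gamma> s) (\<gamma> t) = \<bar>s - t\<bar>"
    using assms(1) unfolding minimizing_geodesic_def d_def by blast+
  have inner: "\<gamma> s \<bullet> \<gamma> t = cos (s - t)" if "s \<in> {0..d}" "t \<in> {0..d}" for s t
  proof -
    have "cos (geodesic_dist (\<gamma> s) (\<gamma> t)) = \<gamma> s \<bullet> \<gamma> t"
      unfolding geodesic_dist_def
      by (intro cos_arccos unit_sphere_inner_bounds sph that)
    then show ?thesis using dist[OF that] by simp
  qed
  have pp: "p \<bullet> p = 1" "q \<bullet> q = 1" "w \<bullet> w = 1" and pq: "p \<bullet> q = cos d" "q \<bullet> p = cos d"
    and wp: "w \<bullet> p = cos u" "p \<bullet> w = cos u" and wq: "w \<bullet> q = cos (d - u)" "q \<bullet> w = cos (d - u)"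
    using inner[of 0 0] inner[of d d] inner[of u u] inner[of 0 d] inner[of d 0] inner[of u 0]
      inner[of 0 u] inner[of u d] inner[of d u] d \<gamma> cos_minus[of "d - u"] by (auto simp: w_def)
  define e where "e = sin d *\<^sub>R w - (sin (d - u) *\<^sub>R p + sin u *\<^sub>R q)"
  have "e \<bullet> e = (sin d)\<^sup>2 + (sin (d - u))\<^sup>2 + (sin u)\<^sup>2
      - 2 * sin d * sin (d - u) * cos u - 2 * sin d * sin u * cos (d - u)
      + 2 * sin (d - u) * sin u * cos d"
    unfolding e_def
    by (simp add: inner_diff_left inner_diff_right inner_add_left inner_add_right pp pq wp wq
        power2_eq_square algebra_simps)
  also have "\<dots> = 0"
  proof -
    \<comment> \<open>With the addition formulas, these two relations leave a polynomial identity in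
      the sines and cosines of \<open>d\<close> and \<open>u\<close>.\<close>
    have "(sin d)\<^sup>2 + (cos d)\<^sup>2 = 1" "(sin u)\<^sup>2 + (cos u)\<^sup>2 = 1" by simp_all
    then show ?thesis unfolding sin_diff cos_diff by algebra
  qed
  finally show ?thesis unfolding e_def d_def w_def by simp
qed

lemma weakly_convex_sgn_add:
  assumes M: "weakly_convex_in_hemisphere M" and pq: "p \<in> M" "q \<in> M"
    and st: "0 < s" "0 < t" and nz: "s *\<^sub>R p + t *\<^sub>R q \<noteq> 0"
  shows "sgn (s *\<^sub>R p + t *\<^sub>R q) \<in> M"
proof -
  define d where "d = geodesic_dist p q"
  have Msph: "m \<in> unit_sphere" if "m \<in> M" for m
    using M that unfolding weakly_convex_in_hemisphere_def hemisphere_def by auto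
  have sM: "sgn m = m" if "m \<in> M" for m using Msph[OF that] by (simp add: sgn_div_norm)
  note bounds = unit_sphere_inner_bounds[OF Msph Msph, OF pq]
  \<comment> \<open>If \<open>q\<close> is \<open>p\<close> or \<open>- p\<close>, the sum is a
    multiple of \<open>p\<close>, and its direction is already \<open>p\<close> or \<open>q\<close>.
    Otherwise \<open>sin d\<close> is positive and the formula for points of the geodesic can be
    solved.\<close>
  consider "q = p" | "q = - p" | "q \<noteq> p" "q \<noteq> - p" by blast
  then show ?thesis
  proof cases
    case 1
    then have "s *\<^sub>R p + t *\<^sub>R q = (s + t) *\<^sub>R p" by (simp add: scaleR_add_left)
    then show ?thesis using pq st sM by (simp add: sgn_scaleR)
  next
    case 2
    then have eq: "s *\<^sub>R p + t *\<^sub>R q = (s - t) *\<^sub>R p" by (simp add: scaleR_diff_left)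
    show ?thesis
    proof (cases "s < t")
      case True
      then show ?thesis using eq 2 pq sM by (simp add: sgn_scaleR)
    next
      case False
      then show ?thesis using eq nz pq sM by (simp add: sgn_scaleR)
    qed
  next
    case 3
    have "p \<bullet> q \<noteq> 1" using 3 unit_sphere_eqI Msph pq by blast
    moreover have "p \<bullet> q \<noteq> - 1"
      using 3 unit_sphere_eqI[of p "- q"] Msph[OF pq(1)] Msph[OF pq(2)] by auto
    ultimately have "-1 < p \<bullet> q" "p \<bullet> q < 1" using bounds by auto
    then have d: "0 < d" "d < pi"
      unfolding d_def geodesic_dist_def using arccos_lt_bounded by auto
    obtain \<gamma> where \<gamma>: "minimizing_geodesic \<gamma> p q" "\<gamma> ` {0..d} \<subseteq> M"
      using M pq unfolding weakly_convex_in_hemisphere_def d_def by blast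
    have sd: "0 < sin d" using d sin_gt_zero by blast
    \<comment> \<open>By that formula, \<open>\<gamma> u\<close> points in the direction of
      \<open>s *\<^sub>R p + t *\<^sub>R q\<close> when \<open>sin (d - u)\<close> and
      \<open>sin u\<close> are in the ratio \<open>s\<close> to \<open>t\<close>. The difference is
      negative at \<open>0\<close> and positive at \<open>d\<close>.\<close>
    have "\<exists>u. 0 \<le> u \<and> u \<le> d \<and> s * sin u - t * sin (d - u) = 0"
      using d sd st by (intro IVT') (auto intro!: continuous_intros)
    then obtain u where u: "0 \<le> u" "u \<le> d" and su: "s * sin u = t * sin (d - u)" by auto
    have "u \<noteq> d" using su sd st by auto
    then have sdu: "0 < sin (d - u)" using u d by (intro sin_gt_zero) auto
    have "sin d *\<^sub>R \<gamma> u = sin (d - u) *\<^sub>R p + sin u *\<^sub>R q"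
      using minimizing_geodesic_point[OF \<gamma>(1)] u d unfolding d_def by blast
    then have "(s * sin d / sin (d - u)) *\<^sub>R \<gamma> u
        = (s / sin (d - u)) *\<^sub>R (sin (d - u) *\<^sub>R p + sin u *\<^sub>R q)"
      by (metis scaleR_scaleR times_divide_eq_left)
    also have "\<dots> = s *\<^sub>R p + t *\<^sub>R q"
      using sdu su by (simp add: scaleR_add_right)
    finally have "s *\<^sub>R p + t *\<^sub>R q = (s * sin d / sin (d - u)) *\<^sub>R \<gamma> u" ..
    moreover have "\<gamma> u \<in> M" using \<gamma>(2) u by auto
    moreover have "0 < s * sin d / sin (d - u)" using st sd sdu by simp
    ultimately show ?thesis using sM by (simp only: sgn_scaleR sgn_pos) simp
  qed
qed

section \<open>Sets without antipodal pairs\<close>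

lemma weakly_convex_zero_notin_hull:
  assumes M: "weakly_convex_in_hemisphere M" and anti: "\<And>p. p \<in> M \<Longrightarrow> - p \<notin> M"
  shows "0 \<notin> convex hull M"
proof -
  \<comment> \<open>The set of positive vectors. It omits \<open>0\<close> and contains
    \<open>M\<close>, so its convexity keeps \<open>0\<close> out of the hull.\<close>
  define D where "D = {v. v \<noteq> 0 \<and> sgn v \<in> M}"
  have nM: "norm m = 1" if "m \<in> M" for m
    using M that unfolding weakly_convex_in_hemisphere_def hemisphere_def by auto
  have "convex D"
  proof (rule convexI)
    fix x y :: 'a and a b :: real
    assume xy: "x \<in> D" "y \<in> D" and ab: "0 \<le> a" "0 \<le> b" "a + b = 1"
    show "a *\<^sub>R x + b *\<^sub>R y \<in> D"
    proof (cases "a = 0 \<or> b = 0")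
      case True
      then show ?thesis using xy ab by auto
    next
      case False
      then have ab': "0 < a" "0 < b" using ab by auto
      have x: "x \<noteq> 0" "sgn x \<in> M" and y: "y \<noteq> 0" "sgn y \<in> M" using xy by (auto simp: D_def)
      have eq: "a *\<^sub>R x + b *\<^sub>R y = (a * norm x) *\<^sub>R sgn x + (b * norm y) *\<^sub>R sgn y"
        using x(1) y(1) unfolding sgn_div_norm scaleR_scaleR by (simp add: mult.assoc)
      have "a *\<^sub>R x + b *\<^sub>R y \<noteq> 0"
      proof
        \<comment> \<open>Two positive vectors that cancel have opposite directions, which would be
          an antipodal pair in \<open>M\<close>.\<close>
        assume "a *\<^sub>R x + b *\<^sub>R y = 0"
        then have "sgn (b *\<^sub>R y) = - sgn (a *\<^sub>R x)"
          by (metis add_eq_0_iff sgn_minus)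
        then show False using anti[OF x(2)] y ab' by (simp add: sgn_scaleR)
      qed
      then show ?thesis
        using weakly_convex_sgn_add[OF M x(2) y(2), of "a * norm x" "b * norm y"] x y ab' eq
        by (simp add: D_def)
    qed
  qed
  moreover have "M \<subseteq> D" using nM by (force simp: D_def sgn_div_norm)
  ultimately have "convex hull M \<subseteq> D" by (rule hull_minimal[rotated])
  then show ?thesis by (auto simp: D_def)
qed

lemma subset_sphere_interior_hemisphere:
  "{p \<in> unit_sphere. p \<bullet> y > 0} \<subseteq> sphere_interior (hemisphere y)"
  unfolding sphere_interior_def
proof (rule interior_of_maximal)
  show "{p \<in> unit_sphere. p \<bullet> y > 0} \<subseteq> hemisphere y" by (auto simp: hemisphere_def)
  have "open {p. p \<bullet> y > 0}"
    by (rule open_Collect_less) (intro continuous_intros)+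
  moreover have "{p \<in> unit_sphere. p \<bullet> y > 0} = unit_sphere \<inter> {p. p \<bullet> y > 0}" by auto
  ultimately show "openin (top_of_set unit_sphere) {p \<in> unit_sphere. p \<bullet> y > 0}"
    by (simp add: openin_open_Int)
qed

lemma open_hemisphere_if_zero_notin_hull:
  assumes "compact M" "M \<subseteq> unit_sphere" "0 \<notin> convex hull M"
  shows "\<exists>U. open_hemisphere U \<and> M \<subseteq> U"
proof -
  have "closed (convex hull M)"
    using assms(1) by (simp add: compact_convex_hull compact_imp_closed)
  then obtain a b where ab: "a \<noteq> 0" "0 < b" "\<And>x. x \<in> convex hull M \<Longrightarrow> a \<bullet> x > b"
    using separating_hyperplane_closed_0[of "convex hull M"] assms(3) by auto
  have "m \<bullet> sgn a > 0" if "m \<in> M" for m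
    using ab(1,2) ab(3)[of m] hull_inc[of m M convex] that
    by (simp add: sgn_div_norm inner_commute)
  then have "M \<subseteq> sphere_interior (hemisphere (sgn a))"
    using subset_sphere_interior_hemisphere[of "sgn a"] assms(2) by blast
  moreover have "sgn a \<in> unit_sphere" using ab by (simp add: norm_sgn)
  ultimately show ?thesis unfolding open_hemisphere_def by blast
qed

section \<open>Rotations and the equator\<close>

text \<open>Moves an equator point off the equator: with \<open>y = - x\<close> out of the
  hemisphere around \<open>x\<close>, with \<open>y = x\<close> into its interior.\<close>

lemma rotation_towards:
  assumes "p \<in> unit_sphere" "y \<in> unit_sphere" "p \<bullet> y = 0"
  shows "cos s *\<^sub>R p + sin s *\<^sub>R y \<in> unit_sphere"
    and "(cos s *\<^sub>R p + sin s *\<^sub>R y) \<bullet> y = sin s"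
    and "((\<lambda>s. cos s *\<^sub>R p + sin s *\<^sub>R y) \<longlongrightarrow> p) (at_right 0)"
proof -
  let ?v = "cos s *\<^sub>R p + sin s *\<^sub>R y"
  have "?v \<bullet> ?v = (cos s)\<^sup>2 + (sin s)\<^sup>2"
    using assms unit_sphere_inner_self[OF assms(1)] unit_sphere_inner_self[OF assms(2)]
    by (simp add: inner_add_left inner_add_right power2_eq_square inner_commute)
  then show "?v \<in> unit_sphere" by (simp add: norm_eq_1)
  show "?v \<bullet> y = sin s"
    using assms unit_sphere_inner_self[OF assms(2)] by (simp add: inner_add_left)
  have "((\<lambda>s. cos s *\<^sub>R p + sin s *\<^sub>R y) \<longlongrightarrow> cos 0 *\<^sub>R p + sin 0 *\<^sub>R y) (at_right 0)"
    by (intro tendsto_intros)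
  then show "((\<lambda>s. cos s *\<^sub>R p + sin s *\<^sub>R y) \<longlongrightarrow> p) (at_right 0)" by simp
qed

lemma eventually_sin_pos: "eventually (\<lambda>s::real. 0 < sin s) (at_right 0)"
  unfolding eventually_at_right_field using sin_gt_zero pi_gt_zero by blast

text \<open>Rotating \<open>p\<close> slightly towards \<open>- x\<close> makes the inner product
  with \<open>x\<close> negative, so every neighbourhood of \<open>p\<close> leaves the
  hemisphere.\<close>

lemma equatorI:
  assumes p: "p \<in> unit_sphere" and x: "x \<in> unit_sphere" and px: "p \<bullet> x = 0"
  shows "p \<in> equator x"
proof -
  have "p \<notin> sphere_interior (hemisphere x)"
  proof
    assume "p \<in> sphere_interior (hemisphere x)"
    then obtain T where T: "openin (top_of_set unit_sphere) T" "p \<in> T" "T \<subseteq> hemisphere x"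
      unfolding sphere_interior_def interior_of_def by blast
    then obtain O' where O': "open O'" "T = unit_sphere \<inter> O'" by (auto simp: openin_open)
    note rot = rotation_towards[OF p, of "- x"]
    have x': "- x \<in> unit_sphere" "p \<bullet> - x = 0" using x px by simp_all
    have "eventually (\<lambda>s. cos s *\<^sub>R p + sin s *\<^sub>R (- x) \<in> O') (at_right 0)"
      using topological_tendstoD[OF rot(3)[OF x'] O'(1)] T O' by blast
    with eventually_sin_pos
    have "eventually (\<lambda>s::real. 0 < sin s \<and> cos s *\<^sub>R p + sin s *\<^sub>R (- x) \<in> O') (at_right 0)"
      by (rule eventually_conj)
    then obtain s :: real where s: "0 < sin s" "cos s *\<^sub>R p + sin s *\<^sub>R (- x) \<in> O'"
      using eventually_happens'[OF trivial_limit_at_right_real] by blast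
    then have "cos s *\<^sub>R p + sin s *\<^sub>R (- x) \<in> hemisphere x"
      using T O' rot(1)[OF x', of s] by blast
    then have "(cos s *\<^sub>R p + sin s *\<^sub>R (- x)) \<bullet> x \<ge> 0" by (simp add: hemisphere_def)
    moreover have "(cos s *\<^sub>R p + sin s *\<^sub>R (- x)) \<bullet> x = - sin s"
      using rot(2)[OF x', of s] by simp
    ultimately show False using s by simp
  qed
  then show ?thesis using p px by (simp add: equator_def hemisphere_def)
qed

section \<open>Stereographic projection of the hemisphere\<close>

text \<open>The half-angle formula writes \<open>tan (r / 2)\<close> as
  \<open>sin r / (cos r + 1)\<close>, and \<open>sin r\<close> is the norm of the tangential part of
  \<open>q\<close>, so it cancels against the normalisation in \<open>sgn\<close>.\<close>

lemma stereographic_eq: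
  assumes x: "x \<in> unit_sphere" and q: "q \<in> unit_sphere" and h: "q \<bullet> x \<ge> 0"
  shows "stereographic x q = (2 / (1 + q \<bullet> x)) *\<^sub>R (q - (q \<bullet> x) *\<^sub>R x)"
proof -
  define r where "r = geodesic_dist x q"
  have cr: "cos r = q \<bullet> x"
    unfolding r_def geodesic_dist_def inner_commute[of q x]
    by (intro cos_arccos unit_sphere_inner_bounds x q)
  have r: "0 \<le> r" "r \<le> pi" unfolding r_def geodesic_dist_def
    by (rule arccos_lbound[OF unit_sphere_inner_bounds[OF x q]]
        arccos_ubound[OF unit_sphere_inner_bounds[OF x q]])+
  let ?v = "q - (q \<bullet> x) *\<^sub>R x"
  have "?v \<bullet> ?v = 1 - (q \<bullet> x)\<^sup>2"
    using unit_sphere_inner_self[OF x] unit_sphere_inner_self[OF q]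
    by (simp add: inner_diff_left inner_diff_right inner_commute power2_eq_square)
  then have "norm ?v = sqrt (1 - (cos r)\<^sup>2)" by (simp only: norm_eq_sqrt_inner cr)
  also have "\<dots> = sin r" by (rule sin_cos_sqrt[OF sin_ge_zero[OF r], symmetric])
  finally have nv: "norm ?v = sin r" .
  have tan: "tan (r / 2) = sin r / (cos r + 1)" using tan_half[of "r / 2"] by simp
  show ?thesis
  proof (cases "?v = 0")
    case True
    then show ?thesis by (simp add: stereographic_def)
  next
    case False
    then have "sin r \<noteq> 0" using nv by auto
    then show ?thesis
      unfolding stereographic_def r_def[symmetric] tan sgn_div_norm nv
      by (simp add: cr add.commute)
  qed
qed

text \<open>With \<open>q \<bullet> x = cos r\<close> this is the square of
  \<open>2 * tan (r / 2)\<close>. It serves to recover the height \<open>q \<bullet> x\<close> from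
  the image, and to bound the image of the hemisphere by radius \<open>2\<close>.\<close>

lemma stereographic_inner_self:
  assumes x: "x \<in> unit_sphere" and q: "q \<in> unit_sphere" and h: "q \<bullet> x \<ge> 0"
  shows "stereographic x q \<bullet> stereographic x q = 4 * (1 - q \<bullet> x) / (1 + q \<bullet> x)"
proof -
  have "(q - (q \<bullet> x) *\<^sub>R x) \<bullet> (q - (q \<bullet> x) *\<^sub>R x) = (1 - q \<bullet> x) * (1 + q \<bullet> x)"
    using unit_sphere_inner_self[OF x] unit_sphere_inner_self[OF q]
    by (simp add: inner_diff_left inner_diff_right inner_commute algebra_simps)
  then have "stereographic x q \<bullet> stereographic x q
      = (2 / (1 + q \<bullet> x)) * ((2 / (1 + q \<bullet> x)) * ((1 - q \<bullet> x) * (1 + q \<bullet> x)))"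
    by (simp add: stereographic_eq[OF assms])
  also have "\<dots> = 4 * (1 - q \<bullet> x) / (1 + q \<bullet> x)"
    using h by (simp add: divide_simps)
  finally show ?thesis .
qed

text \<open>The norm of the image determines the height \<open>q \<bullet> x\<close>, and at fixed
  height the projection is an injective affine map.\<close>

lemma inj_on_stereographic:
  assumes x: "x \<in> unit_sphere"
  shows "inj_on (stereographic x) (hemisphere x)"
proof (rule inj_onI)
  fix q m assume "q \<in> hemisphere x" "m \<in> hemisphere x"
    and eq: "stereographic x q = stereographic x m"
  then have q: "q \<in> unit_sphere" "q \<bullet> x \<ge> 0" and m: "m \<in> unit_sphere" "m \<bullet> x \<ge> 0"
    by (auto simp: hemisphere_def)
  have "4 * (1 - q \<bullet> x) / (1 + q \<bullet> x) = 4 * (1 - m \<bullet> x) / (1 + m \<bullet> x)"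
    using stereographic_inner_self[OF x q] stereographic_inner_self[OF x m] eq by simp
  then have h: "q \<bullet> x = m \<bullet> x"
    using q(2) m(2) by (simp add: frac_eq_eq algebra_simps)
  have "(2 / (1 + m \<bullet> x)) *\<^sub>R (q - (m \<bullet> x) *\<^sub>R x) = (2 / (1 + m \<bullet> x)) *\<^sub>R (m - (m \<bullet> x) *\<^sub>R x)"
    using eq unfolding stereographic_eq[OF x q] stereographic_eq[OF x m] h .
  moreover have "2 / (1 + m \<bullet> x) \<noteq> 0" using m(2) by simp
  ultimately show "q = m" by (metis scaleR_cancel_left diff_add_cancel)
qed

lemma stereographic_in_tangent_space:
  assumes "x \<in> unit_sphere" "q \<in> unit_sphere" "q \<bullet> x \<ge> 0"
  shows "stereographic x q \<in> tangent_space x"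
  using unit_sphere_inner_self[OF assms(1)]
  by (simp add: stereographic_eq[OF assms] tangent_space_def inner_diff_left)

section \<open>From the interior sphere condition to a cap\<close>

text \<open>Containment gives \<open>norm c + \<rho> \<le> R\<close> and the triangle inequality at
  \<open>a\<close> gives the converse. Equality there makes \<open>c\<close> and
  \<open>a - c\<close> parallel, so the centre lies on the segment from \<open>0\<close> to
  \<open>a\<close>.\<close>

lemma internally_tangent_center:
  fixes c a :: "'a::real_inner"
  assumes V: "subspace V" "c \<in> V" and \<rho>: "0 < \<rho>" and R: "V \<inter> ball c \<rho> \<subseteq> cball 0 R"
    and a: "norm a = R" "norm (a - c) = \<rho>" "0 < R"
  shows "\<rho> \<le> R" "R *\<^sub>R c = (R - \<rho>) *\<^sub>R a"
proof -
  have nc: "norm c + \<rho> \<le> R" if "c \<noteq> 0"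
  proof (rule field_le_epsilon)
    fix e :: real assume e: "0 < e"
    \<comment> \<open>The ball is open, so its point farthest from \<open>0\<close> is only
      approximated: \<open>?y\<close> lies beyond \<open>c\<close> on the ray from \<open>0\<close>,
      at distance \<open>s\<close> slightly below \<open>\<rho>\<close>.\<close>
    define s where "s = max 0 (\<rho> - e)"
    have s: "0 \<le> s" "s < \<rho>" "\<rho> - e \<le> s" using e \<rho> by (auto simp: s_def)
    let ?y = "(1 + s / norm c) *\<^sub>R c"
    have y: "?y - c = (s / norm c) *\<^sub>R c" by (simp add: scaleR_add_left)
    have "?y \<in> V" using V by (simp add: subspace_scale)
    moreover have "dist c ?y = s"
      by (subst dist_commute, subst dist_norm, subst y) (use s that in simp)
    ultimately have "norm ?y \<le> R" using R s by (force simp: mem_cball_0)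
    moreover have "norm ?y = norm c + s"
      using s that by (simp add: abs_of_nonneg field_simps)
    ultimately show "norm c + \<rho> \<le> R + e" using s by linarith
  qed
  have tri: "R \<le> norm c + \<rho>" using norm_triangle_ineq[of c "a - c"] a by simp
  \<comment> \<open>For \<open>c = 0\<close> there is no outward direction, but then
    \<open>norm a\<close> is both \<open>R\<close> and \<open>\<rho>\<close>.\<close>
  have eq: "norm c + \<rho> = R"
    using nc tri a by (cases "c = 0") auto
  then show "\<rho> \<le> R" by (metis add_increasing norm_ge_zero order_refl)
  have "norm (c + (a - c)) = norm c + norm (a - c)" using eq a by simp
  then have "norm c *\<^sub>R (a - c) = \<rho> *\<^sub>R c" using norm_triangle_eq a by metis
  then have "norm c *\<^sub>R a = (norm c + \<rho>) *\<^sub>R c"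
    by (simp add: scaleR_diff_right scaleR_add_left algebra_simps)
  moreover have "norm c = R - \<rho>" using eq by simp
  ultimately show "R *\<^sub>R c = (R - \<rho>) *\<^sub>R a" by simp
qed

text \<open>
  The inequality defining the cap is \<open>norm (stereographic x q - c) < \<rho>\<close> for the centre
  \<open>c = (2 - \<rho>) *\<^sub>R p\<close>, which is forced because the image of the hemisphere is a ball of radius \<open>2\<close>.
\<close>

lemma interior_sphere_condition_cap:
  assumes x: "x \<in> unit_sphere" and M: "closed M" "M \<subseteq> hemisphere x"
    and p: "p \<in> unit_sphere" "p \<bullet> x = 0" and isc: "interior_sphere_condition M x p"
  obtains \<rho> where "0 < \<rho>" "\<rho> \<le> 2"
    "\<And>q. q \<in> hemisphere x \<Longrightarrow> (2 - \<rho>) * (1 - q \<bullet> p) < \<rho> * (q \<bullet> x) \<Longrightarrow> q \<in> M"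
proof -
  let ?V = "tangent_space x"
  have Pp: "stereographic x p = 2 *\<^sub>R p" using stereographic_eq[OF x p(1)] p by simp
  obtain c \<rho> where c: "c \<in> ?V" "0 < \<rho>" and sub: "?V \<inter> ball c \<rho> \<subseteq> stereographic x ` M"
    and sph: "2 *\<^sub>R p \<in> sphere c \<rho>"
    using isc unfolding interior_sphere_condition_def interior_sphere_condition_in_def
      closure_closed[OF M(1)] Pp by blast
  have V: "subspace ?V"
    by (auto simp: tangent_space_def subspace_def inner_add_left)
  have "stereographic x m \<in> cball 0 2" if "m \<in> M" for m
  proof -
    have m: "m \<in> unit_sphere" "m \<bullet> x \<ge> 0" using M that by (auto simp: hemisphere_def)
    have "4 * (1 - m \<bullet> x) / (1 + m \<bullet> x) \<le> 4" using m(2) by (simp add: divide_simps)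
    then have "(norm (stereographic x m))\<^sup>2 \<le> 2\<^sup>2"
      unfolding power2_norm_eq_inner stereographic_inner_self[OF x m] by simp
    then have "norm (stereographic x m) \<le> 2" by (rule power2_le_imp_le) simp
    then show ?thesis by simp
  qed
  then have R: "?V \<inter> ball c \<rho> \<subseteq> cball 0 2" using sub by blast
  have "norm (2 *\<^sub>R p) = 2" "norm (2 *\<^sub>R p - c) = \<rho>"
    using p sph by (auto simp: dist_norm norm_minus_commute)
  from internally_tangent_center[OF V c R this]
  have \<rho>: "\<rho> \<le> 2" and "2 *\<^sub>R c = (2 - \<rho>) *\<^sub>R 2 *\<^sub>R p" by simp_all
  then have "2 *\<^sub>R c = 2 *\<^sub>R ((2 - \<rho>) *\<^sub>R p)" by (simp add: mult.commute)
  then have cp: "c = (2 - \<rho>) *\<^sub>R p" by (subst (asm) scaleR_cancel_left) simp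
  have "q \<in> M" if q: "q \<in> hemisphere x" and cap: "(2 - \<rho>) * (1 - q \<bullet> p) < \<rho> * (q \<bullet> x)" for q
  proof -
    have q': "q \<in> unit_sphere" "q \<bullet> x \<ge> 0" using q by (auto simp: hemisphere_def)
    let ?P = "stereographic x q" and ?h = "q \<bullet> x" and ?k = "q \<bullet> p"
    have Ppq: "?P \<bullet> p = 2 * ?k / (1 + ?h)"
      using p by (simp add: stereographic_eq[OF x q'] inner_diff_left inner_commute[of x p])
    have "(norm (?P - c))\<^sup>2 = ?P \<bullet> ?P - 2 * (2 - \<rho>) * (?P \<bullet> p) + (2 - \<rho>)\<^sup>2"
      using unit_sphere_inner_self[OF p(1)]
      unfolding cp power2_norm_eq_inner
      by (simp add: inner_diff_left inner_diff_right inner_commute power2_eq_square algebra_simps)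
    \<comment> \<open>The excess over \<open>\<rho>\<^sup>2\<close> is a positive multiple of the
      difference of the two sides of the cap inequality, so the cap is exactly the preimage of the
      ball in the hemisphere.\<close>
    also have "\<dots> = \<rho>\<^sup>2 + 4 * ((2 - \<rho>) * (1 - ?k) - \<rho> * ?h) / (1 + ?h)"
    proof -
      have "inverse (1 + ?h) * (1 + ?h) = 1" using q'(2) by simp
      then show ?thesis
        unfolding stereographic_inner_self[OF x q'] Ppq divide_inverse by algebra
    qed
    also have "\<dots> < \<rho>\<^sup>2" using cap q'(2) by (simp add: divide_less_0_iff)
    finally have "norm (?P - c) < \<rho>" using c(2) by (simp add: power_less_imp_less_base)
    then have "?P \<in> ball c \<rho>" by (simp add: dist_norm norm_minus_commute)
    then have "?P \<in> stereographic x ` M"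
      using sub stereographic_in_tangent_space[OF x q'] by blast
    then show ?thesis using inj_on_image_mem_iff[OF inj_on_stereographic[OF x] q M(2)] by blast
  qed
  with c(2) \<rho> show thesis by (rule that)
qed

section \<open>Filling the hemisphere from an antipodal pair\<close>

text \<open>An equator point is the limit of its rotations towards \<open>x\<close>, which lie in
  the open hemisphere and hence in the closed set \<open>M\<close>.\<close>

lemma hemisphere_closure:
  assumes x: "x \<in> unit_sphere" and M: "closed M"
    and sub: "\<And>z. z \<in> unit_sphere \<Longrightarrow> z \<bullet> x > 0 \<Longrightarrow> z \<in> M"
  shows "hemisphere x \<subseteq> M"
proof
  fix z assume "z \<in> hemisphere x"
  then have z: "z \<in> unit_sphere" "z \<bullet> x \<ge> 0" by (auto simp: hemisphere_def)
  show "z \<in> M"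
  proof (cases "z \<bullet> x = 0")
    case True
    note rot = rotation_towards[OF z(1) x True]
    have "eventually (\<lambda>s. cos s *\<^sub>R z + sin s *\<^sub>R x \<in> M) (at_right 0)"
      using eventually_sin_pos by eventually_elim (use rot(1,2) sub in auto)
    then show ?thesis using Lim_in_closed_set[OF M _ _ rot(3)] by simp
  qed (use z sub in auto)
qed

lemma antipodal_imp_hemisphere_subset:
  assumes x: "x \<in> unit_sphere" and M: "weakly_convex_in_hemisphere M" "closed M" "M \<subseteq> hemisphere x"
    and p: "p \<in> M" "- p \<in> M" "p \<bullet> x = 0" and isc: "interior_sphere_condition M x p"
  shows "hemisphere x \<subseteq> M"
proof (rule hemisphere_closure[OF x M(2)])
  fix z assume z: "z \<in> unit_sphere" "z \<bullet> x > 0"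
  have p': "p \<in> unit_sphere" using p M by (auto simp: hemisphere_def)
  obtain \<rho> where \<rho>: "0 < \<rho>" "\<rho> \<le> 2"
    and cap: "\<And>q. q \<in> hemisphere x \<Longrightarrow> (2 - \<rho>) * (1 - q \<bullet> p) < \<rho> * (q \<bullet> x) \<Longrightarrow> q \<in> M"
    by (rule interior_sphere_condition_cap[OF x M(2,3) p' p(3) isc]) blast
  \<comment> \<open>This choice turns the right side \<open>\<rho> * (v \<bullet> x)\<close> of the
    cap inequality, scaled by \<open>N\<close>, into \<open>t\<^sup>2\<close>. The left side is at
    most \<open>(2 - \<rho>) * (t\<^sup>2 / 2)\<close>, which is smaller because
    \<open>\<rho>\<close> is positive.\<close>
  define t where "t = \<rho> * (z \<bullet> x)"
  have t: "0 < t" using \<rho> z by (simp add: t_def)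
  define v where "v = p + t *\<^sub>R z"
  define N where "N = norm v"
  have vx: "v \<bullet> x = t * (z \<bullet> x)" using p by (simp add: v_def inner_add_left)
  then have N: "0 < N" using t z by (auto simp: N_def)
  have vp: "v \<bullet> p = 1 + t * (z \<bullet> p)"
    using unit_sphere_inner_self[OF p'] by (simp add: v_def inner_add_left)
  have "N\<^sup>2 = 1 + 2 * t * (z \<bullet> p) + t\<^sup>2"
    using unit_sphere_inner_self[OF p'] unit_sphere_inner_self[OF z(1)]
    unfolding N_def v_def power2_norm_eq_inner
    by (simp add: inner_add_left inner_add_right inner_commute power2_eq_square algebra_simps)
  \<comment> \<open>Bounding \<open>N\<close> by \<open>(N\<^sup>2 + 1) / 2\<close> cancels the
    terms of first order in \<open>t\<close> in \<open>N - v \<bullet> p\<close>.\<close>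
  moreover have "2 * N \<le> N\<^sup>2 + 1" using sum_squares_bound[of N 1] by simp
  ultimately have Nle: "N - v \<bullet> p \<le> t\<^sup>2 / 2" using vp by simp
  have "(2 - \<rho>) * (N - v \<bullet> p) \<le> (2 - \<rho>) * (t\<^sup>2 / 2)"
    using Nle \<rho> by (intro mult_left_mono) auto
  also have "\<dots> < t\<^sup>2" using \<rho> t by (simp add: field_simps)
  also have "t\<^sup>2 = \<rho> * (v \<bullet> x)" by (simp add: vx t_def power2_eq_square)
  finally have lt: "(2 - \<rho>) * (N - v \<bullet> p) < \<rho> * (v \<bullet> x)" .
  have vM: "sgn v \<in> M"
  proof (rule cap)
    show "sgn v \<in> hemisphere x"
      using N vx t z by (simp add: hemisphere_def norm_sgn sgn_div_norm N_def)
    have "(2 - \<rho>) * (1 - sgn v \<bullet> p) = (2 - \<rho>) * (N - v \<bullet> p) / N"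
      using N by (simp add: sgn_div_norm N_def[symmetric] field_simps)
    also have "\<dots> < \<rho> * (v \<bullet> x) / N" using lt N by (simp add: divide_strict_right_mono)
    also have "\<dots> = \<rho> * (sgn v \<bullet> x)" by (simp add: sgn_div_norm N_def[symmetric] field_simps)
    finally show "(2 - \<rho>) * (1 - sgn v \<bullet> p) < \<rho> * (sgn v \<bullet> x)" .
  qed
  \<comment> \<open>Adding \<open>- p\<close> cancels the \<open>p\<close> in \<open>v\<close>: the
    point \<open>z\<close> lies on the arc from \<open>sgn v\<close> to \<open>- p\<close>.\<close>
  have eq: "N *\<^sub>R sgn v + 1 *\<^sub>R (- p) = t *\<^sub>R z"
    using N unfolding sgn_div_norm N_def[symmetric] by (simp add: v_def)
  have "sgn (N *\<^sub>R sgn v + 1 *\<^sub>R (- p)) \<in> M"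
    by (rule weakly_convex_sgn_add[OF M(1) vM p(2) N]) (use t z eq in auto)
  then show "z \<in> M" using t z unfolding eq by (simp add: sgn_scaleR sgn_div_norm)
qed

theorem theorem1p1:
  fixes n :: nat and M :: "'a::euclidean_space set" and x0 :: 'a
  assumes "n \<ge> 1" and "DIM('a) = n + 2"
    and "weakly_convex_body_in_hemisphere M"
    and "x0 \<in> unit_sphere" and "M \<subseteq> hemisphere x0"
    and "\<And>p. p \<in> M \<inter> equator x0 \<Longrightarrow> interior_sphere_condition M x0 p"
  shows "M = hemisphere x0 \<or> (\<exists>U. open_hemisphere U \<and> M \<subseteq> U)"
proof (cases "\<exists>p\<in>M. - p \<in> M")
  case True
  then obtain p where p: "p \<in> M" "- p \<in> M" by blast
  have M: "weakly_convex_in_hemisphere M" "closed M"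
    using assms(3) by (auto simp: weakly_convex_body_in_hemisphere_def compact_imp_closed)
  \<comment> \<open>Both \<open>p\<close> and \<open>- p\<close> have nonnegative inner product with
    \<open>x0\<close>, so it is zero.\<close>
  have "p \<in> unit_sphere" "p \<bullet> x0 = 0"
    using subsetD[OF assms(5) p(1)] subsetD[OF assms(5) p(2)] by (auto simp: hemisphere_def)
  then have "p \<in> M \<inter> equator x0" using p equatorI assms(4) by blast
  then have "hemisphere x0 \<subseteq> M"
    using antipodal_imp_hemisphere_subset assms(4-6) M p \<open>p \<bullet> x0 = 0\<close> by blast
  then show ?thesis using assms(5) by blast
next
  case False
  have "weakly_convex_in_hemisphere M" "compact M" "M \<subseteq> unit_sphere"
    using assms(3,5) by (auto simp: weakly_convex_body_in_hemisphere_def hemisphere_def)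
  then show ?thesis
    using weakly_convex_zero_notin_hull open_hemisphere_if_zero_notin_hull False by blast
qed

end
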